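(* Let $S$ be a semiring. Then the following statements hold: (1) The semiring $S$ can be considered as a subsemiring of $Q(S)$, via the semiring homomorphism $S\to Q(S)$, $s\mapsto s/1$, which is injective. (2) If $S$ is classical, then $S=Q(S)$ (under the identification of $S$ with its image in $Q(S)$ from (1)).
   Context: A semiring is an algebraic structure $(S,+,\cdot,0,1)$ such that $(S,+,0)$ and $(S,\cdot,1)$ are commutative monoids, multiplication distributes over addition, and $s\cdot 0=0$ for all $s\in S$. An element $s\in S$ is multiplicatively cancellative if $sx_1=sx_2$ implies $x_1=x_2$ for all $x_1,x_2\in S$; $MC(S)$ denotes the set of these elements. The total quotient semiring $Q(S)$ is the localization of $S$ at $MC(S)$: its elements are fractions $a/b$ with $a\in S$, $b\in MC(S)$, where $a/b=c/d$ if and only if $ad=bc$, with the usual operations $a/b+c/d=(ad+bc)/(bd)$ and $(a/b)(c/d)=(ac)/(bd)$. An element $s\in S$ is a unit if $st=1$ for some $t\in S$; it is a zero-divisor if $sx=0$ for some nonzero $x\in S$. A semiring is classical if each of its elements is either a unit or a zero-divisor. *)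

theory Defs
  imports "HOL-Algebra.Ring"
begin

text \<open>The locale \<^locale>\<open>semiring\<close> does not make multiplication commutative.
  As usual in \<open>HOL-Algebra\<close>, the zero semiring is not excluded.\<close>

locale csemiring = semiring R + comm_monoid R for R (structure)

text \<open>\<^const>\<open>ring_hom\<close> does not ask for preservation of zero, which is not automatic
  for semirings.\<close>

definition semiring_hom ::
    "('a, 'm) ring_scheme \<Rightarrow> ('b, 'n) ring_scheme \<Rightarrow> ('a \<Rightarrow> 'b) set" where
  "semiring_hom R S = {h \<in> ring_hom R S. h \<zero>\<^bsub>R\<^esub> = \<zero>\<^bsub>S\<^esub>}"

definition subsemiring :: "'a set \<Rightarrow> ('a, 'm) ring_scheme \<Rightarrow> bool" where
  "subsemiring H R \<longleftrightarrow> H \<subseteq> carrier R \<and> \<zero>\<^bsub>R\<^esub> \<in> H \<and> \<one>\<^bsub>R\<^esub> \<in> H \<and>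
     (\<forall>x\<in>H. \<forall>y\<in>H. x \<oplus>\<^bsub>R\<^esub> y \<in> H \<and> x \<otimes>\<^bsub>R\<^esub> y \<in> H)"

definition MC :: "('a, 'm) ring_scheme \<Rightarrow> 'a set" where
  "MC S = {s \<in> carrier S. \<forall>x\<in>carrier S. \<forall>y\<in>carrier S. s \<otimes>\<^bsub>S\<^esub> x = s \<otimes>\<^bsub>S\<^esub> y \<longrightarrow> x = y}"

definition zero_divisor :: "('a, 'm) ring_scheme \<Rightarrow> 'a \<Rightarrow> bool" where
  "zero_divisor S s \<longleftrightarrow> s \<in> carrier S \<and> (\<exists>x\<in>carrier S. x \<noteq> \<zero>\<^bsub>S\<^esub> \<and> s \<otimes>\<^bsub>S\<^esub> x = \<zero>\<^bsub>S\<^esub>)"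

definition classical :: "('a, 'm) ring_scheme \<Rightarrow> bool" where
  "classical S \<longleftrightarrow> (\<forall>s\<in>carrier S. s \<in> Units S \<or> zero_divisor S s)"

definition frac_rel :: "('a, 'm) ring_scheme \<Rightarrow> (('a \<times> 'a) \<times> ('a \<times> 'a)) set" where
  "frac_rel S = {((a, b), (c, d)). (a, b) \<in> carrier S \<times> MC S \<and> (c, d) \<in> carrier S \<times> MC S \<and>
     a \<otimes>\<^bsub>S\<^esub> d = b \<otimes>\<^bsub>S\<^esub> c}"

definition frac :: "('a, 'm) ring_scheme \<Rightarrow> 'a \<Rightarrow> 'a \<Rightarrow> ('a \<times> 'a) set" where
  "frac S a b = frac_rel S `` {(a, b)}"

text \<open>The unions over representatives are unions of equal classes; see the lemmas
  \<open>total_quotient_mult\<close> and \<open>total_quotient_add\<close> below.\<close>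

definition total_quotient :: "('a, 'm) ring_scheme \<Rightarrow> ('a \<times> 'a) set ring" where
  "total_quotient S =
     \<lparr> carrier = (carrier S \<times> MC S) // frac_rel S,
       mult = (\<lambda>X Y. \<Union>(a, b)\<in>X. \<Union>(c, d)\<in>Y. frac S (a \<otimes>\<^bsub>S\<^esub> c) (b \<otimes>\<^bsub>S\<^esub> d)),
       one = frac S \<one>\<^bsub>S\<^esub> \<one>\<^bsub>S\<^esub>,
       zero = frac S \<zero>\<^bsub>S\<^esub> \<one>\<^bsub>S\<^esub>,
       add = (\<lambda>X Y. \<Union>(a, b)\<in>X. \<Union>(c, d)\<in>Y.
         frac S (a \<otimes>\<^bsub>S\<^esub> d \<oplus>\<^bsub>S\<^esub> b \<otimes>\<^bsub>S\<^esub> c) (b \<otimes>\<^bsub>S\<^esub> d)) \<rparr>"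

context csemiring
begin

lemma MC_closed: "s \<in> MC R \<Longrightarrow> s \<in> carrier R"
  by (simp add: MC_def)

lemma MC_cancel:
  "\<lbrakk>s \<in> MC R; x \<in> carrier R; y \<in> carrier R; s \<otimes> x = s \<otimes> y\<rbrakk> \<Longrightarrow> x = y"
  unfolding MC_def by blast

lemma MC_one: "\<one> \<in> MC R"
  by (simp add: MC_def)

lemma MC_mult:
  assumes "s \<in> MC R" "t \<in> MC R"
  shows "s \<otimes> t \<in> MC R"
proof -
  have c: "s \<in> carrier R" "t \<in> carrier R"
    using assms by (auto simp: MC_closed)
  have "x = y" if "x \<in> carrier R" "y \<in> carrier R" "s \<otimes> t \<otimes> x = s \<otimes> t \<otimes> y" for x y
  proof -
    have "s \<otimes> (t \<otimes> x) = s \<otimes> (t \<otimes> y)"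
      using that c by (simp add: m_assoc)
    then have "t \<otimes> x = t \<otimes> y"
      using MC_cancel[OF assms(1)] that c by simp
    then show ?thesis
      using MC_cancel[OF assms(2)] that by simp
  qed
  then show ?thesis
    using c by (simp add: MC_def)
qed

lemma equiv_frac_rel: "equiv (carrier R \<times> MC R) (frac_rel R)"
proof (rule equivI)
  show "frac_rel R \<subseteq> (carrier R \<times> MC R) \<times> (carrier R \<times> MC R)"
    by (auto simp: frac_rel_def)
  show "refl_on (carrier R \<times> MC R) (frac_rel R)"
    by (auto simp: refl_on_def frac_rel_def MC_closed m_comm)
  show "sym (frac_rel R)"
    by (auto simp: sym_def frac_rel_def MC_closed m_comm)
  show "trans (frac_rel R)"
  proof (rule transI, clarify)
    fix a b c d e f
    assume "((a, b), (c, d)) \<in> frac_rel R" and "((c, d), (e, f)) \<in> frac_rel R"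
    then have h: "a \<in> carrier R" "b \<in> MC R" "c \<in> carrier R" "d \<in> MC R" "e \<in> carrier R" "f \<in> MC R"
      and e1: "a \<otimes> d = b \<otimes> c" and e2: "c \<otimes> f = d \<otimes> e"
      by (auto simp: frac_rel_def)
    note m = h(2,4,6)[THEN MC_closed]
    have "d \<otimes> (a \<otimes> f) = (a \<otimes> d) \<otimes> f"
      using h m by (simp add: m_ac)
    also have "\<dots> = b \<otimes> (c \<otimes> f)"
      using h m by (simp add: e1 m_assoc)
    also have "\<dots> = d \<otimes> (b \<otimes> e)"
      using h m by (simp add: e2 m_ac)
    finally have "a \<otimes> f = b \<otimes> e"
      using MC_cancel[OF h(4)] h m by simp
    then show "((a, b), (e, f)) \<in> frac_rel R"
      using h by (simp add: frac_rel_def)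
  qed
qed

lemma frac_eq_iff:
  assumes "a \<in> carrier R" "b \<in> MC R" "c \<in> carrier R" "d \<in> MC R"
  shows "frac R a b = frac R c d \<longleftrightarrow> a \<otimes> d = b \<otimes> c"
  using assms unfolding frac_def
  by (subst eq_equiv_class_iff[OF equiv_frac_rel]) (auto simp: frac_rel_def)

lemma frac_closed:
  "\<lbrakk>a \<in> carrier R; b \<in> MC R\<rbrakk> \<Longrightarrow> frac R a b \<in> carrier (total_quotient R)"
  by (simp add: total_quotient_def frac_def quotientI)

lemma total_quotient_mult:
  assumes "a \<in> carrier R" "b \<in> MC R" "c \<in> carrier R" "d \<in> MC R"
  shows "frac R a b \<otimes>\<^bsub>total_quotient R\<^esub> frac R c d = frac R (a \<otimes> c) (b \<otimes> d)"
proof -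
  have "congruent2 (frac_rel R) (frac_rel R) (\<lambda>(a, b) (c, d). frac R (a \<otimes> c) (b \<otimes> d))"
  proof (rule congruent2I', clarify)
    fix a b a' b' c d c' d'
    assume "((a, b), (a', b')) \<in> frac_rel R" and "((c, d), (c', d')) \<in> frac_rel R"
    then have h: "a \<in> carrier R" "b \<in> MC R" "a' \<in> carrier R" "b' \<in> MC R"
        "c \<in> carrier R" "d \<in> MC R" "c' \<in> carrier R" "d' \<in> MC R"
      and e1: "a \<otimes> b' = b \<otimes> a'" and e2: "c \<otimes> d' = d \<otimes> c'"
      by (auto simp: frac_rel_def)
    note m = h(2,4,6,8)[THEN MC_closed]
    have "(a \<otimes> c) \<otimes> (b' \<otimes> d') = (a \<otimes> b') \<otimes> (c \<otimes> d')"
      using h m by (simp add: m_ac)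
    also have "\<dots> = (b \<otimes> d) \<otimes> (a' \<otimes> c')"
      unfolding e1 e2 using h m by (simp add: m_ac)
    finally show "frac R (a \<otimes> c) (b \<otimes> d) = frac R (a' \<otimes> c') (b' \<otimes> d')"
      using h by (subst frac_eq_iff) (auto simp: MC_mult)
  qed
  from UN_equiv_class2[OF equiv_frac_rel equiv_frac_rel this, of "(a, b)" "(c, d)"] assms
  show ?thesis
    by (simp add: total_quotient_def frac_def case_prod_unfold)
qed

lemma total_quotient_add:
  assumes "a \<in> carrier R" "b \<in> MC R" "c \<in> carrier R" "d \<in> MC R"
  shows "frac R a b \<oplus>\<^bsub>total_quotient R\<^esub> frac R c d = frac R (a \<otimes> d \<oplus> b \<otimes> c) (b \<otimes> d)"
proof -
  have "congruent2 (frac_rel R) (frac_rel R)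
    (\<lambda>(a, b) (c, d). frac R (a \<otimes> d \<oplus> b \<otimes> c) (b \<otimes> d))"
  proof (rule congruent2I', clarify)
    fix a b a' b' c d c' d'
    assume "((a, b), (a', b')) \<in> frac_rel R" and "((c, d), (c', d')) \<in> frac_rel R"
    then have h: "a \<in> carrier R" "b \<in> MC R" "a' \<in> carrier R" "b' \<in> MC R"
        "c \<in> carrier R" "d \<in> MC R" "c' \<in> carrier R" "d' \<in> MC R"
      and e1: "a \<otimes> b' = b \<otimes> a'" and e2: "c \<otimes> d' = d \<otimes> c'"
      by (auto simp: frac_rel_def)
    note m = h(2,4,6,8)[THEN MC_closed]
    have "(a \<otimes> d \<oplus> b \<otimes> c) \<otimes> (b' \<otimes> d') =
        (a \<otimes> b') \<otimes> (d \<otimes> d') \<oplus> (c \<otimes> d') \<otimes> (b \<otimes> b')"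
      by (subst l_distr) (use h m in \<open>simp_all add: m_ac\<close>)
    also have "\<dots> = (b \<otimes> d) \<otimes> (a' \<otimes> d' \<oplus> b' \<otimes> c')"
      unfolding e1 e2 by (subst r_distr) (use h m in \<open>simp_all add: m_ac\<close>)
    finally show "frac R (a \<otimes> d \<oplus> b \<otimes> c) (b \<otimes> d) = frac R (a' \<otimes> d' \<oplus> b' \<otimes> c') (b' \<otimes> d')"
      using h m by (subst frac_eq_iff) (auto simp: MC_mult)
  qed
  from UN_equiv_class2[OF equiv_frac_rel equiv_frac_rel this, of "(a, b)" "(c, d)"] assms
  show ?thesis
    by (simp add: total_quotient_def frac_def case_prod_unfold)
qed

end

end

theory Submission
  imports Defs
begin

text \<open>Computations in \<open>Q(S)\<close> are computations in \<open>S\<close>: each element is a fraction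
  (\<open>total_quotient_cases\<close>), sums and products of fractions are given by the usual formulas, and
  two fractions agree exactly when their cross products do.  So the semiring laws of \<open>Q(S)\<close> are
  inherited from \<open>S\<close> (\<open>csemiring_total_quotient\<close>), and \<open>s/1 = t/1\<close> says just \<open>s = t\<close>.

  For a classical semiring the point is that \<open>MC S\<close> consists of units: a cancellative \<open>s\<close> with
  \<open>s x = 0 = s 0\<close> has \<open>x = 0\<close>, hence is no zero-divisor (\<open>MC_not_zero_divisor\<close>), and so is a
  unit.  A fraction \<open>a/b\<close> then equals \<open>(a b\<inverse>)/1\<close> (\<open>classical_frac_one_surj\<close>).\<close>

context csemiring
begin

lemma total_quotient_cases:
  assumes "X \<in> carrier (total_quotient R)"
  obtains a b where "a \<in> carrier R" "b \<in> MC R" "X = frac R a b"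
  using assms by (auto simp: total_quotient_def frac_def elim!: quotientE)

lemma total_quotient_zero: "\<zero>\<^bsub>total_quotient R\<^esub> = frac R \<zero> \<one>"
  and total_quotient_one: "\<one>\<^bsub>total_quotient R\<^esub> = frac R \<one> \<one>"
  by (simp_all add: total_quotient_def)

lemmas total_quotient_simps =
  total_quotient_mult total_quotient_add total_quotient_zero total_quotient_one
  MC_one MC_mult MC_closed frac_closed

lemma comm_monoid_total_quotient: "comm_monoid (total_quotient R)"
proof (rule comm_monoidI)
  show "\<one>\<^bsub>total_quotient R\<^esub> \<in> carrier (total_quotient R)"
    by (simp add: total_quotient_simps)
next
  fix X assume "X \<in> carrier (total_quotient R)"
  then obtain a b where "a \<in> carrier R" "b \<in> MC R" "X = frac R a b"
    by (rule total_quotient_cases)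
  then show "\<one>\<^bsub>total_quotient R\<^esub> \<otimes>\<^bsub>total_quotient R\<^esub> X = X"
    by (simp add: total_quotient_simps)
next
  fix X Y assume "X \<in> carrier (total_quotient R)" "Y \<in> carrier (total_quotient R)"
  then obtain a b c d where "a \<in> carrier R" "b \<in> MC R" "X = frac R a b"
      "c \<in> carrier R" "d \<in> MC R" "Y = frac R c d"
    by (meson total_quotient_cases)
  then show "X \<otimes>\<^bsub>total_quotient R\<^esub> Y \<in> carrier (total_quotient R)"
    and "X \<otimes>\<^bsub>total_quotient R\<^esub> Y = Y \<otimes>\<^bsub>total_quotient R\<^esub> X"
    by (simp_all add: total_quotient_simps m_comm)
next
  fix X Y Z
  assume "X \<in> carrier (total_quotient R)" "Y \<in> carrier (total_quotient R)"
    "Z \<in> carrier (total_quotient R)"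
  then obtain a b c d e f where "a \<in> carrier R" "b \<in> MC R" "X = frac R a b"
      "c \<in> carrier R" "d \<in> MC R" "Y = frac R c d" "e \<in> carrier R" "f \<in> MC R" "Z = frac R e f"
    by (meson total_quotient_cases)
  then show "X \<otimes>\<^bsub>total_quotient R\<^esub> Y \<otimes>\<^bsub>total_quotient R\<^esub> Z = X \<otimes>\<^bsub>total_quotient R\<^esub> (Y \<otimes>\<^bsub>total_quotient R\<^esub> Z)"
    by (simp add: total_quotient_simps m_assoc)
qed

lemma abelian_monoid_total_quotient: "abelian_monoid (total_quotient R)"
proof (rule abelian_monoidI)
  show "\<zero>\<^bsub>total_quotient R\<^esub> \<in> carrier (total_quotient R)"
    by (simp add: total_quotient_simps)
next
  fix X assume "X \<in> carrier (total_quotient R)"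
  then obtain a b where "a \<in> carrier R" "b \<in> MC R" "X = frac R a b"
    by (rule total_quotient_cases)
  then show "\<zero>\<^bsub>total_quotient R\<^esub> \<oplus>\<^bsub>total_quotient R\<^esub> X = X"
    by (simp add: total_quotient_simps)
next
  fix X Y assume "X \<in> carrier (total_quotient R)" "Y \<in> carrier (total_quotient R)"
  then obtain a b c d where "a \<in> carrier R" "b \<in> MC R" "X = frac R a b"
      "c \<in> carrier R" "d \<in> MC R" "Y = frac R c d"
    by (meson total_quotient_cases)
  then show "X \<oplus>\<^bsub>total_quotient R\<^esub> Y \<in> carrier (total_quotient R)"
    and "X \<oplus>\<^bsub>total_quotient R\<^esub> Y = Y \<oplus>\<^bsub>total_quotient R\<^esub> X"
    by (simp_all add: total_quotient_simps m_comm a_comm)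
next
  fix X Y Z
  assume "X \<in> carrier (total_quotient R)" "Y \<in> carrier (total_quotient R)"
    "Z \<in> carrier (total_quotient R)"
  then obtain a b c d e f where "a \<in> carrier R" "b \<in> MC R" "X = frac R a b"
      "c \<in> carrier R" "d \<in> MC R" "Y = frac R c d" "e \<in> carrier R" "f \<in> MC R" "Z = frac R e f"
    by (meson total_quotient_cases)
  then show "X \<oplus>\<^bsub>total_quotient R\<^esub> Y \<oplus>\<^bsub>total_quotient R\<^esub> Z = X \<oplus>\<^bsub>total_quotient R\<^esub> (Y \<oplus>\<^bsub>total_quotient R\<^esub> Z)"
    by (simp add: total_quotient_simps l_distr r_distr m_ac add.m_assoc)
qed

text \<open>Expanding \<open>(a/b + c/d)(e/f)\<close> and \<open>(a/b)(e/f) + (c/d)(e/f)\<close> gives the denominators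
  \<open>b d f\<close> and \<open>b d f\<^sup>2\<close>, so the two sides are different representatives of one fraction and
  have to be compared by cross products.\<close>

lemma total_quotient_l_distr:
  assumes "X \<in> carrier (total_quotient R)" "Y \<in> carrier (total_quotient R)"
    "Z \<in> carrier (total_quotient R)"
  shows "(X \<oplus>\<^bsub>total_quotient R\<^esub> Y) \<otimes>\<^bsub>total_quotient R\<^esub> Z
    = X \<otimes>\<^bsub>total_quotient R\<^esub> Z \<oplus>\<^bsub>total_quotient R\<^esub> Y \<otimes>\<^bsub>total_quotient R\<^esub> Z"
proof -
  from assms obtain a b c d e f
    where "a \<in> carrier R" "b \<in> MC R" "X = frac R a b" "c \<in> carrier R" "d \<in> MC R"
      "Y = frac R c d" "e \<in> carrier R" "f \<in> MC R" "Z = frac R e f"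
    by (meson total_quotient_cases)
  then show ?thesis
    by (simp add: total_quotient_simps frac_eq_iff l_distr r_distr m_ac)
qed

lemma total_quotient_l_null:
  assumes "X \<in> carrier (total_quotient R)"
  shows "\<zero>\<^bsub>total_quotient R\<^esub> \<otimes>\<^bsub>total_quotient R\<^esub> X = \<zero>\<^bsub>total_quotient R\<^esub>"
proof -
  from assms obtain a b where "a \<in> carrier R" "b \<in> MC R" "X = frac R a b"
    by (rule total_quotient_cases)
  then show ?thesis
    by (simp add: total_quotient_simps frac_eq_iff)
qed

lemma csemiring_total_quotient: "csemiring (total_quotient R)"
proof -
  interpret Q: comm_monoid "total_quotient R"
    by (rule comm_monoid_total_quotient)
  interpret QA: abelian_monoid "total_quotient R"
    by (rule abelian_monoid_total_quotient)
  show ?thesis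
  proof (intro csemiring.intro semiring.intro semiring_axioms.intro)
    show "abelian_monoid (total_quotient R)" "comm_monoid (total_quotient R)"
        "Group.monoid (total_quotient R)"
      by unfold_locales
  next
    fix X Y Z
    assume c: "X \<in> carrier (total_quotient R)" "Y \<in> carrier (total_quotient R)"
      "Z \<in> carrier (total_quotient R)"
    then show "(X \<oplus>\<^bsub>total_quotient R\<^esub> Y) \<otimes>\<^bsub>total_quotient R\<^esub> Z = X \<otimes>\<^bsub>total_quotient R\<^esub> Z \<oplus>\<^bsub>total_quotient R\<^esub> Y \<otimes>\<^bsub>total_quotient R\<^esub> Z"
      by (rule total_quotient_l_distr)
    then show "Z \<otimes>\<^bsub>total_quotient R\<^esub> (X \<oplus>\<^bsub>total_quotient R\<^esub> Y) = Z \<otimes>\<^bsub>total_quotient R\<^esub> X \<oplus>\<^bsub>total_quotient R\<^esub> Z \<otimes>\<^bsub>total_quotient R\<^esub> Y"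
      using c by (metis Q.m_comm QA.a_closed)
  next
    fix X assume c: "X \<in> carrier (total_quotient R)"
    then show "\<zero>\<^bsub>total_quotient R\<^esub> \<otimes>\<^bsub>total_quotient R\<^esub> X = \<zero>\<^bsub>total_quotient R\<^esub>"
      by (rule total_quotient_l_null)
    then show "X \<otimes>\<^bsub>total_quotient R\<^esub> \<zero>\<^bsub>total_quotient R\<^esub> = \<zero>\<^bsub>total_quotient R\<^esub>"
      using c by (metis Q.m_comm QA.zero_closed)
  qed
qed

lemma frac_one_hom: "(\<lambda>s. frac R s \<one>) \<in> semiring_hom R (total_quotient R)"
  by (auto simp: semiring_hom_def ring_hom_def total_quotient_simps)

lemma inj_on_frac_one: "inj_on (\<lambda>s. frac R s \<one>) (carrier R)"
  by (rule inj_onI) (simp add: frac_eq_iff MC_one)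

lemma subsemiring_hom_image:
  assumes "h \<in> semiring_hom R T"
  shows "subsemiring (h ` carrier R) T"
proof -
  have "h \<zero> = \<zero>\<^bsub>T\<^esub>" "h \<one> = \<one>\<^bsub>T\<^esub>" "h ` carrier R \<subseteq> carrier T"
    and add: "\<And>x y. \<lbrakk>x \<in> carrier R; y \<in> carrier R\<rbrakk> \<Longrightarrow> h x \<oplus>\<^bsub>T\<^esub> h y = h (x \<oplus> y)"
    and mult: "\<And>x y. \<lbrakk>x \<in> carrier R; y \<in> carrier R\<rbrakk> \<Longrightarrow> h x \<otimes>\<^bsub>T\<^esub> h y = h (x \<otimes> y)"
    using assms by (auto simp: semiring_hom_def ring_hom_def)
  moreover have "h \<zero> \<in> h ` carrier R" "h \<one> \<in> h ` carrier R"
    by simp_all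
  ultimately show ?thesis
    unfolding subsemiring_def by (auto simp: add mult)
qed

lemma MC_not_zero_divisor:
  assumes "s \<in> MC R"
  shows "\<not> zero_divisor R s"
proof
  assume "zero_divisor R s"
  then obtain x where x: "x \<in> carrier R" "x \<noteq> \<zero>" "s \<otimes> x = s \<otimes> \<zero>"
    using assms by (auto simp: zero_divisor_def MC_closed)
  then show False
    using MC_cancel[OF assms] by blast
qed

lemma classical_frac_one_surj:
  assumes "classical R"
  shows "(\<lambda>s. frac R s \<one>) ` carrier R = carrier (total_quotient R)"
proof
  show "(\<lambda>s. frac R s \<one>) ` carrier R \<subseteq> carrier (total_quotient R)"
    by (auto simp: frac_closed MC_one)
  show "carrier (total_quotient R) \<subseteq> (\<lambda>s. frac R s \<one>) ` carrier R"
  proof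
    fix X assume "X \<in> carrier (total_quotient R)"
    then obtain a b where ab: "a \<in> carrier R" "b \<in> MC R" "X = frac R a b"
      by (rule total_quotient_cases)
    then have "b \<in> Units R"
      using assms MC_not_zero_divisor by (auto simp: classical_def MC_closed)
    then have inv: "inv b \<in> carrier R" "b \<otimes> inv b = \<one>"
      by simp_all
    have "b \<otimes> (a \<otimes> inv b) = a \<otimes> (b \<otimes> inv b)"
      using ab inv(1) by (simp add: m_lcomm MC_closed)
    then have "X = frac R (a \<otimes> inv b) \<one>"
      using ab inv by (simp add: frac_eq_iff MC_one)
    then show "X \<in> (\<lambda>s. frac R s \<one>) ` carrier R"
      using ab inv by blast
  qed
qed

end

theorem proposition3p19:
  fixes S :: "('a, 'm) ring_scheme"
  assumes "csemiring S"
  shows "(csemiring (total_quotient S) \<and>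
          (\<lambda>s. frac S s \<one>\<^bsub>S\<^esub>) \<in> semiring_hom S (total_quotient S) \<and>
          inj_on (\<lambda>s. frac S s \<one>\<^bsub>S\<^esub>) (carrier S) \<and>
          subsemiring ((\<lambda>s. frac S s \<one>\<^bsub>S\<^esub>) ` carrier S) (total_quotient S))
       \<and> (classical S \<longrightarrow> (\<lambda>s. frac S s \<one>\<^bsub>S\<^esub>) ` carrier S = carrier (total_quotient S))"
proof -
  interpret csemiring S
    by (rule assms)
  show ?thesis
    using csemiring_total_quotient frac_one_hom inj_on_frac_one
      subsemiring_hom_image[OF frac_one_hom] classical_frac_one_surj
    by blast
qed

end
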